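(* Let $G=(V,E)$ be a cubic, $3$-edge-connected Hamiltonian graph with $n=|V|$, and identify $V$ with the node set $V_n$ of $K_n$. Then the everywhere $\frac67$ vector for $G$ is in $T^n$.
   Context: $K_n=(V_n,E_n)$ is the complete graph on $n$ nodes. For a graph $G=(V,E)$ on $V=V_n$ and $\lambda\in\mathbb{R}$, the everywhere $\lambda$ vector for $G$ is the vector $y\in\mathbb{R}^{E_n}$ with $y_e=\lambda$ for $e\in E$ and $y_e=0$ for all other edges of $K_n$. A tour is a multiset $J$ of edges of $K_n$ such that $(V_n,J)$ is connected with all degrees even; its incidence vector records multiplicities (which may be arbitrarily large); $T^n$ is the convex hull of incidence vectors of all tours of $K_n$. *)

theory Defs
  imports "HOL-Analysis.Analysis" "HOL-Library.Multiset"
begin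

text \<open>
  The node set of the complete graph is the universe of a finite type \<open>'v\<close>, so \<open>n = CARD('v)\<close>.
  An edge is a two-element set of nodes, and a simple graph on all nodes is a set of such edges.
\<close>

definition K_edges :: "'v::finite set set" where
  "K_edges = {e. card e = 2}"

definition graph_connected :: "'v::finite set set \<Rightarrow> bool" where
  "graph_connected E \<longleftrightarrow> (\<forall>u v. (u, v) \<in> {(x, y). {x, y} \<in> E}\<^sup>*)"

definition edge_connected :: "nat \<Rightarrow> 'v::finite set set \<Rightarrow> bool" where
  "edge_connected k E \<longleftrightarrow>
     2 \<le> CARD('v) \<and> (\<forall>F. F \<subseteq> E \<and> card F < k \<longrightarrow> graph_connected (E - F))"

definition cubic :: "'v::finite set set \<Rightarrow> bool" where
  "cubic E \<longleftrightarrow> (\<forall>v. card {e \<in> E. v \<in> e} = 3)"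

definition hamiltonian :: "'v::finite set set \<Rightarrow> bool" where
  "hamiltonian E \<longleftrightarrow>
     (\<exists>vs. 3 \<le> length vs \<and> distinct vs \<and> set vs = UNIV \<and>
       (\<forall>i. Suc i < length vs \<longrightarrow> {vs ! i, vs ! Suc i} \<in> E) \<and> {last vs, hd vs} \<in> E)"

text \<open>
  A vector indexed by the edges of the complete graph is represented in \<open>real ^ ('v set)\<close>, with
  coordinate 0 at every index that is not a two-element set; the vectors of graphs and tours lie in this
  coordinate subspace.
\<close>

definition everywhere_vec :: "real \<Rightarrow> 'v::finite set set \<Rightarrow> real ^ ('v set)" where
  "everywhere_vec l E = (\<chi> e. if e \<in> E then l else 0)"

definition is_tour :: "'v::finite set multiset \<Rightarrow> bool" where
  "is_tour J \<longleftrightarrow> set_mset J \<subseteq> K_edges \<and> graph_connected (set_mset J) \<and>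
     (\<forall>v. even (size {#e \<in># J. v \<in> e#}))"

definition incidence_vec :: "'v::finite set multiset \<Rightarrow> real ^ ('v set)" where
  "incidence_vec J = (\<chi> e. real (count J e))"

definition tour_hull :: "(real ^ ('v::finite set)) set" where
  "tour_hull = convex hull (incidence_vec ` {J. is_tour J})"

end

theory Submission
  imports Defs
begin

text \<open>
  Since \<open>T\<^sup>n\<close> is closed under increasing coordinates, LP duality reduces the claim to finding, for all
  weights \<open>w \<ge> 0\<close> on \<open>E\<close>, a tour of weight at most \<open>6/7 w(E)\<close>. Let \<open>H\<close> be a Hamiltonian cycle and
  \<open>M = E - H\<close>, a perfect matching. One candidate is \<open>H\<close> itself. For the other, note that contracting
  \<open>M\<close> leaves a 4-regular graph with edge set \<open>H\<close> which is 4-edge-connected, all its cuts being even and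
  of size at least 3; hence some \<open>F \<subseteq> H\<close> with \<open>w(F) \<le> w(H)/2\<close> makes \<open>M \<union> F\<close> connected. The
  vector that is \<open>1/4\<close> on \<open>H\<close> and \<open>1/2\<close> on \<open>M\<close> has value at least 1 on every cut, because a cut meets
  \<open>H\<close> in at least four edges, or in two and then meets \<open>M\<close> as well. So by the Edmonds--Johnson theorem
  the degree parities of \<open>M \<union> F\<close> can be corrected by a join \<open>J\<close> with \<open>w(J) \<le> w(H)/4 + w(M)/2\<close>.
  The tour \<open>M + F + J\<close> weighs at most \<open>3/4 w(H) + 3/2 w(M)\<close>, and averaging the two candidates with
  coefficients \<open>3/7\<close> and \<open>4/7\<close> gives \<open>6/7 w(E)\<close>.
\<close>

section \<open>Cuts and joins\<close>

definition edge_cut :: "'v set set \<Rightarrow> 'v set \<Rightarrow> 'v set set" where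
  "edge_cut E S = {e \<in> E. e \<inter> S \<noteq> {} \<and> e - S \<noteq> {}}"

definition deg :: "'v set set \<Rightarrow> 'v \<Rightarrow> nat" where
  "deg E v = card {e \<in> E. v \<in> e}"

text \<open>These are the \<open>T\<close>-joins of \<open>E\<close>. They are sets rather than
  multisets, so that symmetric difference adds degrees modulo 2.\<close>

definition is_join :: "'v set set \<Rightarrow> 'v set \<Rightarrow> 'v set set \<Rightarrow> bool" where
  "is_join E T J \<longleftrightarrow> J \<subseteq> E \<and> (\<forall>v. odd (deg J v) \<longleftrightarrow> v \<in> T)"

lemma K_edgesE:
  assumes "e \<in> K_edges"
  obtains u v where "e = {u, v}" "u \<noteq> v"
  using assms by (auto simp: K_edges_def card_2_iff)

lemma cut_edgeE:
  assumes "e \<in> edge_cut E S" "E \<subseteq> K_edges"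
  obtains u v where "e = {u, v}" "u \<in> S" "v \<notin> S" "e \<in> E"
proof -
  have "e \<in> K_edges" using assms by (auto simp: edge_cut_def)
  then obtain x y where "e = {x, y}" by (rule K_edgesE)
  then show thesis using assms(1) that[of x y] that[of y x] by (auto simp: edge_cut_def insert_commute)
qed

lemma cut_edgeI: "{u, v} \<in> E \<Longrightarrow> u \<in> S \<Longrightarrow> v \<notin> S \<Longrightarrow> {u, v} \<in> edge_cut E S"
  by (auto simp: edge_cut_def)

text \<open>The nodes reachable from a fixed node form a set with empty cut; conversely, no path can
  leave such a set.\<close>

lemma graph_connected_iff_cut:
  assumes "E \<subseteq> (K_edges :: 'v::finite set set)"
  shows "graph_connected E \<longleftrightarrow> (\<forall>S. S \<noteq> {} \<and> S \<noteq> UNIV \<longrightarrow> edge_cut E S \<noteq> {})"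
proof
  assume con: "graph_connected E"
  show "\<forall>S. S \<noteq> {} \<and> S \<noteq> UNIV \<longrightarrow> edge_cut E S \<noteq> {}"
  proof (intro allI impI notI)
    fix S :: "'v set"
    assume S: "S \<noteq> {} \<and> S \<noteq> UNIV" and c: "edge_cut E S = {}"
    from S obtain u v where uv: "u \<in> S" "v \<notin> S" by blast
    have "(u, v) \<in> {(x, y). {x, y} \<in> E}\<^sup>*" using con by (simp add: graph_connected_def)
    then have "v \<in> S"
    proof (induction rule: rtrancl_induct)
      case base
      show ?case by (fact uv)
    next
      case (step y z)
      then show ?case using c cut_edgeI[of y z E S] by auto
    qed
    with uv show False by simp
  qed
next
  assume cuts: "\<forall>S. S \<noteq> {} \<and> S \<noteq> UNIV \<longrightarrow> edge_cut E S \<noteq> {}"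
  show "graph_connected E"
    unfolding graph_connected_def
  proof (intro allI)
    fix u v
    define S where "S = {x. (u, x) \<in> {(x, y). {x, y} \<in> E}\<^sup>*}"
    have "edge_cut E S = {}"
    proof (rule ccontr)
      assume "edge_cut E S \<noteq> {}"
      then obtain e where "e \<in> edge_cut E S" by blast
      then obtain x y where "e = {x, y}" "x \<in> S" "y \<notin> S" "e \<in> E"
        using assms by (rule cut_edgeE)
      then show False by (auto simp: S_def intro: rtrancl_into_rtrancl)
    qed
    moreover have "u \<in> S" by (simp add: S_def)
    ultimately have "S = UNIV" using cuts by blast
    then show "(u, v) \<in> {(x, y). {x, y} \<in> E}\<^sup>*" by (auto simp: S_def)
  qed
qed

lemma graph_connected_mono:
  assumes "graph_connected E" "E \<subseteq> F"
  shows "graph_connected F"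
proof -
  have "{(x, y). {x, y} \<in> E}\<^sup>* \<subseteq> {(x, y). {x, y} \<in> F}\<^sup>*"
    using assms(2) by (intro rtrancl_mono) auto
  then show ?thesis using assms(1) unfolding graph_connected_def by blast
qed

lemma edge_connected_cut:
  assumes "edge_connected k (E :: 'v::finite set set)" "E \<subseteq> K_edges" "S \<noteq> {}" "S \<noteq> UNIV"
  shows "k \<le> card (edge_cut E S)"
proof (rule ccontr)
  assume "\<not> ?thesis"
  moreover have "edge_cut E S \<subseteq> E" by (auto simp: edge_cut_def)
  ultimately have "graph_connected (E - edge_cut E S)"
    using assms(1) by (auto simp: edge_connected_def)
  then have "edge_cut (E - edge_cut E S) S \<noteq> {}"
    using assms by (subst (asm) graph_connected_iff_cut) auto
  then show False by (auto simp: edge_cut_def)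
qed

text \<open>Double counting: the degrees in \<open>S\<close> count each edge
  \<open>card (e \<inter> S)\<close> times, which is odd exactly for the edges that cross the
  boundary of \<open>S\<close>.\<close>

lemma cut_parity:
  assumes "J \<subseteq> (K_edges :: 'v::finite set set)"
  shows "even (card (edge_cut J S)) \<longleftrightarrow> even (card {v \<in> S. odd (deg J v)})"
proof -
  have "(\<Sum>v\<in>S. deg J v) = (\<Sum>v\<in>S. \<Sum>e\<in>J. if v \<in> e then 1 else 0)"
    by (simp add: deg_def sum.If_cases Int_def)
  also have "\<dots> = (\<Sum>e\<in>J. \<Sum>v\<in>S. if v \<in> e then 1 else 0)" by (rule sum.swap)
  also have "\<dots> = (\<Sum>e\<in>J. card (e \<inter> S))"
    by (simp add: sum.If_cases Int_def conj_commute)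
  finally have eq: "(\<Sum>v\<in>S. deg J v) = (\<Sum>e\<in>J. card (e \<inter> S))" .
  have "odd (card (e \<inter> S)) \<longleftrightarrow> e \<inter> S \<noteq> {} \<and> e - S \<noteq> {}" if "e \<in> J" for e
  proof -
    from that assms obtain u v where "e = {u, v}" "u \<noteq> v" by (blast elim: K_edgesE)
    then show ?thesis
      by (cases "u \<in> S"; cases "v \<in> S") (auto simp: Int_insert_left)
  qed
  then have "{e \<in> J. odd (card (e \<inter> S))} = edge_cut J S" by (auto simp: edge_cut_def)
  then show ?thesis
    using arg_cong[OF eq, of even] even_sum_iff[of S "deg J"] even_sum_iff[of J "\<lambda>e. card (e \<inter> S)"]
    by simp
qed

section \<open>Joins under symmetric difference\<close>

lemma odd_card_sym_diff:
  assumes "finite A" "finite B"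
  shows "odd (card (sym_diff A B)) \<longleftrightarrow> odd (card A) \<noteq> odd (card B)"
proof -
  have "card (sym_diff A B) = card (A - B) + card (B - A)"
    using assms by (subst card_Un_disjoint) auto
  moreover have "card A = card (A - B) + card (A \<inter> B)"
    using assms by (metis card_Diff_subset_Int card_mono finite_Int inf_le1 le_add_diff_inverse2)
  moreover have "card B = card (B - A) + card (A \<inter> B)"
    using assms by (metis card_Diff_subset_Int card_mono finite_Int inf_commute inf_le1 le_add_diff_inverse2)
  ultimately show ?thesis by auto
qed

lemma is_join_sym_diff:
  assumes "is_join E T J" "is_join E U (K :: 'v::finite set set)"
  shows "is_join E (sym_diff T U) (sym_diff J K)"
proof -
  have "odd (deg (sym_diff J K) v) \<longleftrightarrow> odd (deg J v) \<noteq> odd (deg K v)" for v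
  proof -
    have "{e \<in> sym_diff J K. v \<in> e} = sym_diff {e \<in> J. v \<in> e} {e \<in> K. v \<in> e}" by auto
    then show ?thesis by (simp add: deg_def odd_card_sym_diff)
  qed
  with assms show ?thesis by (auto simp: is_join_def)
qed

lemma is_join_edge: "{u, v} \<in> E \<Longrightarrow> u \<noteq> v \<Longrightarrow> is_join E (sym_diff {u} {v}) {{u, v}}"
proof -
  assume uv: "{u, v} \<in> E" "u \<noteq> v"
  have "{e \<in> {{u, v}}. x \<in> e} = (if x \<in> {u, v} then {{u, v}} else {})" for x by auto
  with uv show ?thesis by (auto simp: is_join_def deg_def)
qed

lemma is_join_empty: "is_join E {} {}"
  by (simp add: is_join_def deg_def)

lemma is_join_mono: "is_join E T J \<Longrightarrow> E \<subseteq> F \<Longrightarrow> is_join F T J"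
  by (auto simp: is_join_def)

lemma is_join_cong: "is_join E T J \<Longrightarrow> T = U \<Longrightarrow> is_join E U J"
  by simp

lemma is_join_cut_parity:
  assumes "is_join E T J" "E \<subseteq> (K_edges :: 'v::finite set set)"
  shows "even (card (edge_cut J S)) \<longleftrightarrow> even (card (S \<inter> T))"
proof -
  have "{v \<in> S. odd (deg J v)} = S \<inter> T" using assms by (auto simp: is_join_def)
  moreover have "J \<subseteq> K_edges" using assms by (auto simp: is_join_def)
  ultimately show ?thesis using cut_parity[of J S] by simp
qed

text \<open>
  A join with odd vertices \<open>a\<close> and \<open>v\<close> exists iff some path links them, so \<open>reach E a\<close> is the connected
  component of \<open>a\<close>; joins compose by symmetric difference, without any bookkeeping for simple paths.
\<close>

definition reach :: "'v set set \<Rightarrow> 'v \<Rightarrow> 'v set" where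
  "reach E a = {v. \<exists>P. is_join E (sym_diff {a} {v}) P}"

lemma reach_refl: "a \<in> reach E a"
  by (auto simp: reach_def intro: is_join_empty)

lemma cut_reach:
  assumes "E \<subseteq> (K_edges :: 'v::finite set set)"
  shows "edge_cut E (reach E a) = {}"
proof (rule ccontr)
  assume "edge_cut E (reach E a) \<noteq> {}"
  then obtain e where "e \<in> edge_cut E (reach E a)" by blast
  then obtain u v where uv: "e = {u, v}" "u \<in> reach E a" "v \<notin> reach E a" "e \<in> E"
    using assms by (rule cut_edgeE)
  then obtain P where P: "is_join E (sym_diff {a} {u}) P" by (auto simp: reach_def)
  have "is_join E (sym_diff (sym_diff {a} {u}) (sym_diff {u} {v})) (sym_diff P {e})"
    using uv by (intro is_join_sym_diff P) (auto intro: is_join_edge)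
  then have "is_join E (sym_diff {a} {v}) (sym_diff P {e})" by (rule is_join_cong) auto
  with uv show False by (auto simp: reach_def)
qed

lemma is_join_exists:
  assumes "E \<subseteq> (K_edges :: 'v::finite set set)" "graph_connected E" "even (card T)"
  shows "\<exists>J. is_join E T J"
proof -
  fix r :: 'v
  have univ: "reach E r = UNIV"
    using cut_reach[OF assms(1), of r] assms(2) reach_refl[of r E]
    unfolding graph_connected_iff_cut[OF assms(1)] by blast
  \<comment> \<open>Linking the nodes of \<open>T\<close> to a root \<open>r\<close> one by one
    gives a join with odd set \<open>T\<close>, except possibly at \<open>r\<close>; the parity of
    \<open>card T\<close> then excludes the exception.\<close>
  have "\<exists>J. is_join E T J \<or> is_join E (sym_diff T {r}) J"
    using finite[of T]
  proof (induction T rule: finite_induct)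
    case empty
    show ?case using is_join_empty by blast
  next
    case (insert x T)
    obtain P where P: "is_join E (sym_diff {r} {x}) P" using univ by (auto simp: reach_def)
    from insert.IH obtain J where "is_join E T J \<or> is_join E (sym_diff T {r}) J" ..
    then have "is_join E (sym_diff (insert x T) {r}) (sym_diff J P) \<or> is_join E (insert x T) (sym_diff J P)"
    proof
      assume "is_join E T J"
      from is_join_sym_diff[OF this P] have "is_join E (sym_diff (insert x T) {r}) (sym_diff J P)"
        by (rule is_join_cong) (use insert.hyps in auto)
      then show ?thesis ..
    next
      assume "is_join E (sym_diff T {r}) J"
      from is_join_sym_diff[OF this P] have "is_join E (insert x T) (sym_diff J P)"
        by (rule is_join_cong) (use insert.hyps in auto)
      then show ?thesis ..
    qed
    then show ?case by blast
  qed
  moreover have "\<not> is_join E (sym_diff T {r}) J" for J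
  proof
    assume "is_join E (sym_diff T {r}) J"
    from is_join_cut_parity[OF this assms(1), of UNIV] have "even (card (sym_diff T {r}))"
      by (simp add: edge_cut_def)
    with assms(3) show False using odd_card_sym_diff[of T "{r}"] by simp
  qed
  ultimately show ?thesis by blast
qed


lemma sum_sym_diff:
  fixes w :: "'a \<Rightarrow> real"
  assumes "finite A" "finite B"
  shows "sum w (sym_diff A B) = sum w A + sum w B - 2 * sum w (A \<inter> B)"
proof -
  have "sum w (sym_diff A B) = sum w (A - B) + sum w (B - A)"
    using assms by (subst sum.union_disjoint) auto
  moreover have "sum w A = sum w (A \<inter> B) + sum w (A - B)" using assms by (intro sum.Int_Diff)
  moreover have "sum w B = sum w (B \<inter> A) + sum w (B - A)" using assms by (intro sum.Int_Diff)
  ultimately show ?thesis by (simp add: Int_commute)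
qed

text \<open>Each element of \<open>P\<close> lies in exactly one of \<open>A\<close> and
  \<open>B\<close>, and switching both along \<open>P\<close> moves it to the other one.\<close>

lemma sum_sym_diff_exchange:
  fixes w :: "'a \<Rightarrow> real"
  assumes "finite A" "finite B" "P \<subseteq> sym_diff A B"
  shows "sum w (sym_diff A P) + sum w (sym_diff B P) = sum w A + sum w B"
proof -
  have P: "finite P" using assms finite_subset by blast
  have "sum w P = sum w (P \<inter> A) + sum w (P - A)" using P by (intro sum.Int_Diff)
  moreover have "P - A = B \<inter> P" using assms(3) by auto
  ultimately have "sum w P = sum w (A \<inter> P) + sum w (B \<inter> P)" by (simp add: Int_commute)
  then show ?thesis
    unfolding sum_sym_diff[OF assms(1) P] sum_sym_diff[OF assms(2) P] by simp
qed

section \<open>Minimum joins and fractional joins\<close>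

text \<open>
  Choose \<open>a\<close>, \<open>b\<close> so that the minimum weight of a join for \<open>T\<close> with \<open>a\<close> and \<open>b\<close> toggled is as small as
  possible. Then no optimal join \<open>K\<close> for that set can leave the zero-weight component \<open>S\<close> of \<open>b\<close>: deleting
  an edge of \<open>K\<close> that leaves \<open>S\<close> would move \<open>b\<close> across the cut at a profit. Switching a minimum \<open>T\<close>-join
  \<open>J\<close> along a path of the symmetric difference of \<open>J\<close> and \<open>K\<close> from \<open>a\<close> until it first enters \<open>S\<close>
  again gives such an optimal join, so \<open>J\<close> crosses the boundary of \<open>S\<close> only in the last edge of that path.
\<close>

lemma tight_cut:
  fixes E :: "'v::finite set set" and w :: "'v set \<Rightarrow> real"
  assumes E: "E \<subseteq> K_edges" and w: "\<And>e. e \<in> E \<Longrightarrow> 0 \<le> w e"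
    and ex: "is_join E T J0" and pos: "\<And>J. is_join E T J \<Longrightarrow> 0 < sum w J"
  shows "\<exists>S. odd (card (S \<inter> T)) \<and> (\<forall>e\<in>edge_cut E S. 0 < w e) \<and>
    (\<forall>J. is_join E T J \<and> (\<forall>J'. is_join E T J' \<longrightarrow> sum w J \<le> sum w J') \<longrightarrow> card (edge_cut J S) = 1)"
proof -
  define U where "U a b = sym_diff T (sym_diff {a} {b})" for a b
  define Q where "Q = {(a, b, K). is_join E (U a b) K}"
  have "(undefined, undefined, J0) \<in> Q" using ex by (simp add: Q_def U_def)
  then have Q: "finite Q" "Q \<noteq> {}" by auto
  then obtain q where q: "q \<in> Q" "\<And>q'. q' \<in> Q \<Longrightarrow> sum w (snd (snd q)) \<le> sum w (snd (snd q'))"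
    using arg_min_if_finite(1)[OF Q, of "\<lambda>q. sum w (snd (snd q))"]
      arg_min_least[OF Q, of _ "\<lambda>q. sum w (snd (snd q))"] by blast
  obtain a b K where qK: "q = (a, b, K)" by (cases q)
  have K: "is_join E (U a b) K" using q(1) by (simp add: Q_def qK)
  have min: "sum w K \<le> sum w K'" if "is_join E (U a' b') K'" for a' b' K'
    using q(2)[of "(a', b', K')"] that by (simp add: Q_def qK)
  have w_le: "sum w (sym_diff A B) \<le> sum w A + sum w B" if "A \<subseteq> E" "B \<subseteq> E" for A B
  proof -
    have "0 \<le> sum w (A \<inter> B)" using that w by (intro sum_nonneg) auto
    then show ?thesis by (simp add: sum_sym_diff)
  qed
  have drop: "sum w (J - {e}) = sum w J - w e" if "e \<in> J" for J e
    using that by (simp add: sum_diff1)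
  have drop_join: "is_join E (sym_diff V (sym_diff {u} {v})) (J - {{u, v}})"
    if "is_join E V J" "{u, v} \<in> J" "u \<noteq> v" for V J u v
  proof -
    have "{u, v} \<in> E" using that by (auto simp: is_join_def)
    moreover have "sym_diff J {{u, v}} = J - {{u, v}}" using that by auto
    ultimately show ?thesis using is_join_sym_diff[OF that(1) is_join_edge[of u v E]] that by simp
  qed
  define Z where "Z = {e \<in> E. w e = 0}"
  have ZE: "Z \<subseteq> E" and ZK: "Z \<subseteq> K_edges" using E by (auto simp: Z_def)
  define S where "S = reach Z b"
  have zero: "\<exists>P. is_join E (sym_diff {x} {y}) P \<and> sum w P = 0" if "x \<in> S" "y \<in> S" for x y
  proof -
    obtain P P' where P: "is_join Z (sym_diff {b} {x}) P" and P': "is_join Z (sym_diff {b} {y}) P'"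
      using \<open>x \<in> S\<close> \<open>y \<in> S\<close> unfolding S_def reach_def by blast
    have join: "is_join Z (sym_diff {x} {y}) (sym_diff P P')"
      using is_join_sym_diff[OF P P'] by (rule is_join_cong) auto
    then have "sum w (sym_diff P P') = 0" by (intro sum.neutral) (auto simp: is_join_def Z_def)
    with join show ?thesis using is_join_mono ZE by blast
  qed
  have cut_pos: "0 < w e" if "e \<in> edge_cut E S" for e
  proof -
    have "e \<notin> edge_cut Z S" using cut_reach[OF ZK] by (simp add: S_def)
    moreover have "e \<in> E" using that by (simp add: edge_cut_def)
    ultimately show ?thesis using that w[of e] by (auto simp: edge_cut_def Z_def)
  qed
  \<comment> \<open>A \<open>T\<close>-join has positive weight, hence an edge of positive weight.
    Deleting that edge toggles its two ends and leaves a strictly lighter competitor of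
    \<open>K\<close>.\<close>
  have less: "sum w K < sum w J" if J: "is_join E T J" for J
  proof -
    have "\<not> (\<forall>e\<in>J. w e \<le> 0)" using pos[OF J] sum_nonpos[of J w] by force
    then obtain e where e: "e \<in> J" "0 < w e" by force
    then have "e \<in> K_edges" using J E by (auto simp: is_join_def)
    then obtain u v where uv: "e = {u, v}" "u \<noteq> v" by (rule K_edgesE)
    have "is_join E (U u v) (J - {e})" using drop_join[OF J] e uv by (simp add: U_def)
    then have "sum w K \<le> sum w (J - {e})" by (rule min)
    with e show ?thesis by (simp add: drop)
  qed
  have a: "a \<notin> S"
  proof
    assume "a \<in> S"
    then obtain P where P: "is_join E (sym_diff {a} {b}) P" "sum w P = 0"
      using zero[of a b] reach_refl[of b Z] by (auto simp: S_def)
    have "is_join E T (sym_diff K P)"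
      using is_join_sym_diff[OF K P(1)] by (rule is_join_cong) (auto simp: U_def)
    then have "sum w K < sum w (sym_diff K P)" by (rule less)
    also have "\<dots> \<le> sum w K + sum w P" using K P by (intro w_le) (auto simp: is_join_def)
    finally show False using P by simp
  qed
  \<comment> \<open>Stated for every \<open>b1\<close> in \<open>S\<close>, because the path built
    below may enter \<open>S\<close> at a node other than \<open>b\<close>.\<close>
  have avoid: "edge_cut K' S = {}" if K': "is_join E (U a b1) K'" "sum w K' \<le> sum w K" and b1: "b1 \<in> S" for b1 K'
  proof (rule ccontr)
    assume "edge_cut K' S \<noteq> {}"
    then obtain e where e: "e \<in> edge_cut K' S" by blast
    have K'E: "K' \<subseteq> E" using K' by (simp add: is_join_def)
    obtain u v where uv: "e = {u, v}" "u \<in> S" "v \<notin> S" "e \<in> K'"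
      using cut_edgeE[OF e] K'E E by blast
    obtain P where P: "is_join E (sym_diff {b1} {u}) P" "sum w P = 0" using zero[OF b1 uv(2)] by blast
    have "u \<noteq> v" using uv by blast
    then have D: "is_join E (sym_diff (U a b1) (sym_diff {u} {v})) (K' - {e})"
      using drop_join[OF K'(1)] uv by simp
    have "is_join E (U a v) (sym_diff (K' - {e}) P)"
      using is_join_sym_diff[OF D P(1)] by (rule is_join_cong) (auto simp: U_def)
    then have "sum w K \<le> sum w (sym_diff (K' - {e}) P)" by (rule min)
    also have "\<dots> \<le> sum w (K' - {e}) + sum w P" using K'E P by (intro w_le) (auto simp: is_join_def)
    also have "\<dots> = sum w K' - w e" using P uv by (simp add: drop)
    also have "\<dots> < sum w K" using cut_pos[of e] e K'E K'(2) by (force simp: edge_cut_def)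
    finally show False by simp
  qed
  have one: "card (edge_cut J S) = 1"
    if J: "is_join E T J" and Jmin: "\<And>J'. is_join E T J' \<Longrightarrow> sum w J \<le> sum w J'" for J
  proof -
    define X where "X = sym_diff J K"
    have XE: "X \<subseteq> E" using J K by (auto simp: X_def is_join_def)
    then have XK: "X \<subseteq> K_edges" using E by blast
    have "is_join E (sym_diff {a} {b}) X"
      unfolding X_def using is_join_sym_diff[OF J K] by (rule is_join_cong) (auto simp: U_def)
    then have X: "is_join X (sym_diff {a} {b}) X" by (simp add: is_join_def)
    define Y where "Y = {e \<in> X. e \<inter> S = {}}"
    define C where "C = reach Y a"
    have YK: "Y \<subseteq> K_edges" using XK by (auto simp: Y_def)
    have CS: "C \<inter> S = {}"
    proof (rule ccontr)
      assume "C \<inter> S \<noteq> {}"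
      then obtain x where x: "x \<in> C" "x \<in> S" by blast
      then obtain P where P: "is_join Y (sym_diff {a} {x}) P" by (auto simp: C_def reach_def)
      have "x \<noteq> a" using a x by blast
      then have "odd (deg P x)" using P by (simp add: is_join_def)
      then have "{e \<in> P. x \<in> e} \<noteq> {}" unfolding deg_def by (metis card.empty even_zero)
      then show False using P x by (auto simp: is_join_def Y_def)
    qed
    \<comment> \<open>Of \<open>a\<close> and \<open>b\<close> only \<open>a\<close> lies in
      \<open>C\<close>, so by parity some edge of \<open>X\<close> leaves \<open>C\<close>. It
      cannot belong to \<open>Y\<close>, so it ends in \<open>S\<close>: this is the first entry
      into \<open>S\<close>.\<close>
    have "b \<in> S" "a \<in> C" by (simp_all add: S_def C_def reach_refl)
    then have "C \<inter> sym_diff {a} {b} = {a}" using CS a by auto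
    then have "odd (card (edge_cut X C))" using is_join_cut_parity[OF X XK, of C] by simp
    then have "edge_cut X C \<noteq> {}" by (metis card.empty even_zero)
    then obtain e where "e \<in> edge_cut X C" by blast
    then obtain c b1 where cb: "e = {c, b1}" "c \<in> C" "b1 \<notin> C" "e \<in> X" using XK by (rule cut_edgeE)
    have b1: "b1 \<in> S"
    proof (rule ccontr)
      assume "b1 \<notin> S"
      then have "e \<in> Y" using cb CS by (auto simp: Y_def)
      then have "e \<in> edge_cut Y C" using cb cut_edgeI[of c b1 Y C] by simp
      then show False using cut_reach[OF YK] by (auto simp: C_def)
    qed
    obtain P0 where P0: "is_join Y (sym_diff {a} {c}) P0" using cb by (auto simp: C_def reach_def)
    have P0X: "P0 \<subseteq> X" "e \<notin> P0" using P0 b1 cb by (auto simp: is_join_def Y_def)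
    define P where "P = insert e P0"
    have "is_join E (sym_diff {a} {c}) P0" using P0 by (rule is_join_mono) (use XE in \<open>auto simp: Y_def\<close>)
    moreover have "is_join E (sym_diff {c} {b1}) {e}" using cb XE by (auto intro: is_join_edge)
    ultimately have "is_join E (sym_diff (sym_diff {a} {c}) (sym_diff {c} {b1})) (sym_diff P0 {e})"
      by (rule is_join_sym_diff)
    then have "is_join E (sym_diff {a} {b1}) (sym_diff P0 {e})" by (rule is_join_cong) auto
    moreover have "sym_diff P0 {e} = P" using P0X by (auto simp: P_def)
    ultimately have P: "is_join E (sym_diff {a} {b1}) P" by simp
    have JP: "is_join E (U a b1) (sym_diff J P)" using is_join_sym_diff[OF J P] by (simp add: U_def)
    have KP: "is_join E (sym_diff (U a b) (sym_diff {a} {b1})) (sym_diff K P)"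
      by (rule is_join_sym_diff[OF K P])
    \<comment> \<open>The free join \<open>R\<close> moves \<open>b1\<close> back to
      \<open>b\<close> and so turns the switched \<open>K\<close> into a \<open>T\<close>-join, to
      which minimality of \<open>J\<close> applies. The exchange identity then makes the switched
      \<open>J\<close> no heavier than \<open>K\<close>.\<close>
    obtain R where R: "is_join E (sym_diff {b} {b1}) R" "sum w R = 0"
      using zero[OF \<open>b \<in> S\<close> b1] by blast
    have "is_join E T (sym_diff (sym_diff K P) R)"
      using is_join_sym_diff[OF KP R(1)] by (rule is_join_cong) (auto simp: U_def)
    then have "sum w J \<le> sum w (sym_diff (sym_diff K P) R)" by (rule Jmin)
    also have "\<dots> \<le> sum w (sym_diff K P) + sum w R"
      using K P R by (intro w_le) (auto simp: is_join_def)
    finally have "sum w J \<le> sum w (sym_diff K P)" using R by simp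
    moreover have "sum w (sym_diff J P) + sum w (sym_diff K P) = sum w J + sum w K"
      by (rule sum_sym_diff_exchange) (use P0X cb in \<open>auto simp: P_def X_def\<close>)
    ultimately have "sum w (sym_diff J P) \<le> sum w K" by simp
    then have "edge_cut (sym_diff J P) S = {}" using avoid[OF JP] b1 by simp
    then have "edge_cut J S = edge_cut P S" by (auto simp: edge_cut_def)
    moreover have "c \<notin> S" using cb CS by blast
    then have "edge_cut P S = {e}" using P0 b1 cb by (auto simp: edge_cut_def P_def is_join_def Y_def)
    ultimately show ?thesis by simp
  qed
  have "odd (card (S \<inter> T))"
  proof -
    have fin: "finite {J. is_join E T J}" "{J. is_join E T J} \<noteq> {}" using ex by auto
    define J where "J = arg_min_on (sum w) {J. is_join E T J}"
    have "is_join E T J" using arg_min_if_finite(1)[OF fin, of "sum w"] by (simp add: J_def)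
    moreover from this have "card (edge_cut J S) = 1"
      by (rule one) (use arg_min_least[OF fin, of _ "sum w"] in \<open>simp add: J_def\<close>)
    ultimately show ?thesis using is_join_cut_parity[of E T J S] E by simp
  qed
  with cut_pos one show ?thesis by blast
qed

lemma finite_pos_lower_bound:
  fixes A :: "real set"
  assumes "finite A" "\<And>a. a \<in> A \<Longrightarrow> 0 < a"
  shows "\<exists>\<epsilon>>0. \<forall>a\<in>A. \<epsilon> \<le> a"
  using assms by (intro exI[of _ "Min (insert 1 A)"]) auto

text \<open>
  The nontrivial half of the Edmonds--Johnson theorem. Lowering \<open>w\<close> by a small amount on a tight cut does not
  increase \<open>w \<bullet> z\<close> minus the minimum weight of a \<open>T\<close>-join; a weighting of least total among all those obtainable
  without increasing this quantity therefore admits a \<open>T\<close>-join of weight 0.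
\<close>

lemma join_le_fractional:
  fixes E :: "'v::finite set set" and w z :: "'v set \<Rightarrow> real"
  assumes E: "E \<subseteq> K_edges" "graph_connected E" and T: "even (card T)"
    and w: "\<And>e. e \<in> E \<Longrightarrow> 0 \<le> w e" and z: "\<And>e. e \<in> E \<Longrightarrow> 0 \<le> z e"
    and cuts: "\<And>S. odd (card (S \<inter> T)) \<Longrightarrow> 1 \<le> sum z (edge_cut E S)"
  shows "\<exists>J. is_join E T J \<and> sum w J \<le> (\<Sum>e\<in>E. w e * z e)"
proof -
  obtain J1 where J1: "is_join E T J1" using is_join_exists E T by blast
  then have fin: "finite {J. is_join E T J}" "{J. is_join E T J} \<noteq> {}" by auto
  define Jw where "Jw = arg_min_on (sum w) {J. is_join E T J}"
  have Jw: "is_join E T Jw" using arg_min_if_finite(1)[OF fin, of "sum w"] by (simp add: Jw_def)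
  have Jw_min: "sum w Jw \<le> sum w J" if "is_join E T J" for J
    using arg_min_least[OF fin, of J "sum w"] that by (simp add: Jw_def)
  define c where "c = (\<Sum>e\<in>E. w e * z e) - sum w Jw"
  define W :: "real ^ 'v set" where "W = (\<chi> e. if e \<in> E then w e else 0)"
  \<comment> \<open>The weightings between 0 and \<open>w\<close> whose product with
    \<open>z\<close> exceeds the minimum weight of a join by at most \<open>c\<close>. The goal is
    \<open>0 \<le> c\<close>; compactness provides a member of least total.\<close>
  define A where "A = cbox 0 W \<inter>
    {x. \<forall>J\<in>{J. is_join E T J}. (\<Sum>e\<in>E. x $ e * z e) - c \<le> (\<Sum>e\<in>J. x $ e)}"
  have "compact A"
    unfolding A_def Collect_ball_eq
    by (intro compact_Int_closed compact_cbox closed_INT ballI closed_Collect_le continuous_intros)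
  moreover have "W \<in> A"
  proof -
    have "(\<Sum>e\<in>J. W $ e) = sum w J" if "is_join E T J" for J
      using that by (intro sum.cong) (auto simp: W_def is_join_def)
    moreover have "(\<Sum>e\<in>E. W $ e * z e) = (\<Sum>e\<in>E. w e * z e)"
      by (intro sum.cong) (auto simp: W_def)
    ultimately show ?thesis using w Jw_min by (auto simp: A_def c_def mem_box_cart W_def)
  qed
  moreover have "continuous_on A (\<lambda>x. \<Sum>e\<in>UNIV. x $ e)" by (intro continuous_intros)
  ultimately obtain x where x: "x \<in> A" and xmin: "\<And>y. y \<in> A \<Longrightarrow> (\<Sum>e\<in>UNIV. x $ e) \<le> (\<Sum>e\<in>UNIV. y $ e)"
    using continuous_attains_inf[of A "\<lambda>x. \<Sum>e\<in>UNIV. x $ e"] by blast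
  define u where "u = ($) x"
  have u: "0 \<le> u e" "u e \<le> W $ e" for e using x by (auto simp: A_def mem_box_cart u_def)
  have uA: "(\<Sum>e\<in>E. u e * z e) - c \<le> sum u J" if "is_join E T J" for J
    using x that by (auto simp: A_def u_def)
  have "0 \<le> c"
  proof (cases "\<exists>J. is_join E T J \<and> sum u J \<le> 0")
    case True
    then obtain J where "is_join E T J" "sum u J \<le> 0" by blast
    then have "(\<Sum>e\<in>E. u e * z e) \<le> c" using uA[of J] by simp
    moreover have "0 \<le> (\<Sum>e\<in>E. u e * z e)" using u z by (intro sum_nonneg) auto
    ultimately show ?thesis by simp
  next
    case False
    define Ju where "Ju = arg_min_on (sum u) {J. is_join E T J}"
    have Ju: "is_join E T Ju" using arg_min_if_finite(1)[OF fin, of "sum u"] by (simp add: Ju_def)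
    have Ju_min: "sum u Ju \<le> sum u J" if "is_join E T J" for J
      using arg_min_least[OF fin, of J "sum u"] that by (simp add: Ju_def)
    have "\<exists>S. odd (card (S \<inter> T)) \<and> (\<forall>e\<in>edge_cut E S. 0 < u e) \<and>
      (\<forall>J. is_join E T J \<and> (\<forall>J'. is_join E T J' \<longrightarrow> sum u J \<le> sum u J') \<longrightarrow> card (edge_cut J S) = 1)"
      using E(1) u(1) J1 False by (intro tight_cut) (auto simp: not_le)
    then obtain S where S: "odd (card (S \<inter> T))" "\<And>e. e \<in> edge_cut E S \<Longrightarrow> 0 < u e"
      and one: "\<And>J. is_join E T J \<Longrightarrow> (\<And>J'. is_join E T J' \<Longrightarrow> sum u J \<le> sum u J') \<Longrightarrow> card (edge_cut J S) = 1"
      by blast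
    define N where "N = real (card E) + 1"
    have N: "0 < N" by (simp add: N_def)
    \<comment> \<open>Upper bounds for \<open>\<epsilon>\<close>: weights on the cut stay
      nonnegative, and a join that is not minimum, losing at most \<open>\<epsilon> * N\<close>,
      stays at least as heavy as the old minimum.\<close>
    define B where "B = u ` edge_cut E S \<union> (\<lambda>J. (sum u J - sum u Ju) / N) ` {J. is_join E T J \<and> sum u Ju < sum u J}"
    have "\<exists>\<epsilon>>0. \<forall>a\<in>B. \<epsilon> \<le> a"
      using S(2) N by (intro finite_pos_lower_bound) (auto simp: B_def)
    then obtain \<epsilon> where eps: "0 < \<epsilon>" "\<And>a. a \<in> B \<Longrightarrow> \<epsilon> \<le> a" by blast
    define y :: "real ^ 'v set" where "y = (\<chi> e. u e - (if e \<in> edge_cut E S then \<epsilon> else 0))"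
    have sum_y: "(\<Sum>e\<in>J. y $ e) = sum u J - \<epsilon> * card (edge_cut J S)" if "J \<subseteq> E" for J
    proof -
      have "J \<inter> edge_cut E S = edge_cut J S" using that by (auto simp: edge_cut_def)
      then show ?thesis by (simp add: y_def sum_subtractf sum.If_cases Int_def)
    qed
    have "y \<in> A"
      unfolding A_def
    proof (intro IntI CollectI ballI)
      show "y \<in> cbox 0 W"
        unfolding mem_box_cart
      proof (intro allI conjI)
        fix e
        show "0 $ e \<le> y $ e" using u(1)[of e] eps(2)[of "u e"] by (auto simp: y_def B_def)
        show "y $ e \<le> W $ e" using u(2)[of e] eps(1) by (auto simp: y_def)
      qed
      fix J
      assume "J \<in> {J. is_join E T J}"
      then have J: "is_join E T J" by simp
      then have JE: "J \<subseteq> E" by (simp add: is_join_def)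
      have "(\<Sum>e\<in>E. y $ e * z e) = (\<Sum>e\<in>E. u e * z e - (if e \<in> edge_cut E S then \<epsilon> * z e else 0))"
        by (intro sum.cong) (auto simp: y_def algebra_simps)
      also have "\<dots> = (\<Sum>e\<in>E. u e * z e) - \<epsilon> * sum z (edge_cut E S)"
      proof -
        have "E \<inter> edge_cut E S = edge_cut E S" by (auto simp: edge_cut_def)
        then show ?thesis by (simp add: sum_subtractf sum.If_cases sum_distrib_left)
      qed
      also have "\<dots> \<le> (\<Sum>e\<in>E. u e * z e) - \<epsilon>"
        using mult_left_mono[OF cuts[OF S(1)], of \<epsilon>] eps(1) by simp
      finally have le: "(\<Sum>e\<in>E. y $ e * z e) \<le> (\<Sum>e\<in>E. u e * z e) - \<epsilon>" .
      show "(\<Sum>e\<in>E. y $ e * z e) - c \<le> (\<Sum>e\<in>J. y $ e)"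
      proof (cases "sum u Ju < sum u J")
        case True
        then have "\<epsilon> \<le> (sum u J - sum u Ju) / N" using J by (intro eps) (auto simp: B_def)
        then have "\<epsilon> * N \<le> sum u J - sum u Ju" using N by (simp add: field_simps)
        moreover have "card (edge_cut J S) \<le> card E"
          using JE by (intro card_mono) (auto simp: edge_cut_def)
        then have "\<epsilon> * card (edge_cut J S) \<le> \<epsilon> * N" using eps(1) by (simp add: N_def)
        ultimately show ?thesis using le uA[OF Ju] eps(1) sum_y[OF JE] by linarith
      next
        case False
        then have "card (edge_cut J S) = 1" using Ju_min by (intro one J) force
        then show ?thesis using le uA[OF J] sum_y[OF JE] by simp
      qed
    qed
    \<comment> \<open>Least total leaves no cut edge to lower, yet the minimum join
      \<open>Ju\<close> crosses this cut once.\<close>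
    then have "(\<Sum>e\<in>UNIV. u e) \<le> (\<Sum>e\<in>UNIV. y $ e)" using xmin by (simp add: u_def)
    also have "\<dots> = (\<Sum>e\<in>UNIV. u e) - \<epsilon> * card (edge_cut E S)"
      by (simp add: y_def sum_subtractf sum.If_cases)
    finally have "card (edge_cut E S) = 0" using eps(1) by (simp add: mult_le_0_iff)
    then have "edge_cut Ju S = {}" using Ju by (auto simp: edge_cut_def is_join_def)
    moreover have "card (edge_cut Ju S) = 1" using one[OF Ju Ju_min] .
    ultimately show ?thesis by simp
  qed
  with Jw show ?thesis by (auto simp: c_def)
qed

section \<open>Cheap connectors\<close>

text \<open>The closed sets are the unions of fibres of \<open>c\<close>, that is, the node sets of
  the graph in which every fibre is contracted.\<close>

definition label_closed :: "('v \<Rightarrow> 'l) \<Rightarrow> 'v set \<Rightarrow> bool" where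
  "label_closed c S \<longleftrightarrow> (\<forall>u v. c u = c v \<longrightarrow> u \<in> S \<longrightarrow> v \<in> S)"

text \<open>\<open>connects c F\<close> says that \<open>F\<close> becomes connected once every fibre of \<open>c\<close> is contracted.\<close>

definition connects :: "('v \<Rightarrow> 'l) \<Rightarrow> 'v set set \<Rightarrow> bool" where
  "connects c F \<longleftrightarrow> (\<forall>S. S \<noteq> {} \<longrightarrow> label_closed c S \<longrightarrow> edge_cut F S = {} \<longrightarrow> S = UNIV)"

text \<open>
  Kruskal's algorithm: the \<open>k\<close> fibres of \<open>c\<close> are joined by at least \<open>2 k\<close> edges, while a connector has at most
  \<open>k - 1\<close> edges. So lowering the weight of all these edges by \<open>t\<close>, until the cheapest one is free, decreases
  half their total weight by at least \<open>t k\<close> and the connector by less; then the free edge is contracted.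
\<close>

lemma connector_le_half:
  fixes H :: "'v::finite set set" and c :: "'v \<Rightarrow> 'l" and w :: "'v set \<Rightarrow> real"
  assumes "H \<subseteq> K_edges" and "\<And>e. e \<in> H \<Longrightarrow> 0 \<le> w e"
    and "\<And>S. S \<noteq> {} \<Longrightarrow> S \<noteq> UNIV \<Longrightarrow> label_closed c S \<Longrightarrow> 4 \<le> card (edge_cut H S)"
  shows "\<exists>F\<subseteq>H. card F < card (range c) \<and> sum w F \<le> sum w {e \<in> H. card (c ` e) = 2} / 2 \<and>
    connects c F"
  using assms(2,3)
proof (induction "card (range c)" arbitrary: c w rule: less_induct)
  case less
  note w = less.prems(1) and cuts = less.prems(2)
  show ?case
  proof (cases "card (range c) = 1")
    case True
    then have "c u = c v" for u v by (metis card_1_singletonE rangeI singletonD)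
    then have "connects c {}" unfolding connects_def label_closed_def by blast
    then show ?thesis
      using True sum_nonneg[of "{e \<in> H. card (c ` e) = 2}" w] w by (intro exI[of _ "{}"]) auto
  next
    case False
    define X where "X = {e \<in> H. card (c ` e) = 2}"
    have "card (range c) \<noteq> 0" by simp
    with False have k: "2 \<le> card (range c)" by linarith
    have cutX: "edge_cut H (c -` {l}) \<subseteq> X" for l
    proof
      fix e
      assume "e \<in> edge_cut H (c -` {l})"
      then obtain u v where "e = {u, v}" "u \<in> c -` {l}" "v \<notin> c -` {l}" "e \<in> H"
        using assms(1) by (rule cut_edgeE)
      then show "e \<in> X" by (auto simp: X_def)
    qed
    \<comment> \<open>Each fibre has at least four boundary edges, and an edge of \<open>X\<close>
      is on the boundary of at most two fibres.\<close>
    have "4 * card (range c) \<le> 2 * card X"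
    proof -
      have "4 \<le> card (edge_cut H (c -` {l}))" if "l \<in> range c" for l
      proof (rule cuts)
        show "c -` {l} \<noteq> {}" using that by auto
        show "c -` {l} \<noteq> UNIV"
        proof
          assume "c -` {l} = UNIV"
          then have "range c = {l}" by auto
          with False show False by simp
        qed
        show "label_closed c (c -` {l})" by (simp add: label_closed_def)
      qed
      then have "(\<Sum>l\<in>range c. 4) \<le> (\<Sum>l\<in>range c. card (edge_cut H (c -` {l})))"
        by (intro sum_mono)
      also have "\<dots> = (\<Sum>l\<in>range c. \<Sum>e\<in>X. if e \<in> edge_cut H (c -` {l}) then 1 else 0)"
        using cutX by (intro sum.cong) (auto simp: sum.If_cases Int_absorb1)
      also have "\<dots> = (\<Sum>e\<in>X. \<Sum>l\<in>range c. if e \<in> edge_cut H (c -` {l}) then 1 else 0)"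
        by (rule sum.swap)
      also have "\<dots> \<le> (\<Sum>e\<in>X. 2)"
      proof (rule sum_mono)
        fix e
        assume "e \<in> X"
        then have "card (c ` e) = 2" by (simp add: X_def)
        moreover have "{l \<in> range c. e \<in> edge_cut H (c -` {l})} \<subseteq> c ` e"
        proof
          fix l
          assume "l \<in> {l \<in> range c. e \<in> edge_cut H (c -` {l})}"
          then obtain v where "v \<in> e" "c v = l" by (auto simp: edge_cut_def)
          then show "l \<in> c ` e" by blast
        qed
        ultimately have "card {l \<in> range c. e \<in> edge_cut H (c -` {l})} \<le> 2"
          by (metis card_mono finite finite_imageI)
        then show "(\<Sum>l\<in>range c. if e \<in> edge_cut H (c -` {l}) then 1 else 0) \<le> (2::nat)"
          by (simp add: sum.If_cases Int_def)
      qed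
      finally show ?thesis by simp
    qed
    then have kX: "2 * card (range c) \<le> card X" by simp
    then have X: "finite X" "X \<noteq> {}" using k by auto
    define f where "f = arg_min_on w X"
    have f: "f \<in> X" using arg_min_if_finite(1)[OF X] by (simp add: f_def)
    have fmin: "w f \<le> w e" if "e \<in> X" for e using arg_min_least[OF X that] by (simp add: f_def)
    have XH: "X \<subseteq> H" by (auto simp: X_def)
    have "f \<in> K_edges" using f XH assms(1) by blast
    then obtain x y where xy: "f = {x, y}" by (rule K_edgesE)
    have cxy: "c x \<noteq> c y" using f by (auto simp: X_def xy)
    \<comment> \<open>Merging the fibre of \<open>y\<close> into that of \<open>x\<close> contracts
      the cheapest edge \<open>f\<close>.\<close>
    define c' where "c' v = (if c v = c y then c x else c v)" for v
    have c'_cong: "c' u = c' v" if "c u = c v" for u v using that by (simp add: c'_def)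
    have "range c' \<subseteq> range c - {c y}" using cxy by (auto simp: c'_def)
    then have "card (range c') \<le> card (range c - {c y})" by (intro card_mono) auto
    then have card': "card (range c') < card (range c)" using k by simp
    define w' where "w' e = (if e \<in> X then w e - w f else w e)" for e
    have w': "0 \<le> w' e" if "e \<in> H" for e using w[OF that] fmin by (auto simp: w'_def)
    have "\<exists>F\<subseteq>H. card F < card (range c') \<and> sum w' F \<le> sum w' {e \<in> H. card (c' ` e) = 2} / 2 \<and>
      connects c' F"
    proof (rule less.hyps)
      show "4 \<le> card (edge_cut H S)"
        if S: "S \<noteq> {}" "S \<noteq> UNIV" "label_closed c' S" for S
      proof (rule cuts[OF S(1,2)])
        show "label_closed c S" using S(3) c'_cong unfolding label_closed_def by blast
      qed
    qed (use card' w' in simp_all)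
    then obtain F where F: "F \<subseteq> H" "card F < card (range c')"
      "sum w' F \<le> sum w' {e \<in> H. card (c' ` e) = 2} / 2"
      and con: "connects c' F"
      by blast
    have "{e \<in> H. card (c' ` e) = 2} \<subseteq> X"
    proof
      fix e
      assume e: "e \<in> {e \<in> H. card (c' ` e) = 2}"
      then have "e \<in> K_edges" using assms(1) by blast
      then obtain u v where uv: "e = {u, v}" by (rule K_edgesE)
      with e have "c' u \<noteq> c' v" by auto
      then have "c u \<noteq> c v" using c'_cong by blast
      with e uv show "e \<in> X" by (auto simp: X_def)
    qed
    then have "sum w' {e \<in> H. card (c' ` e) = 2} \<le> sum w' X"
      using w' XH by (intro sum_mono2) auto
    also have "\<dots> = sum w X - w f * card X" by (simp add: w'_def sum_subtractf)
    finally have 1: "sum w' F \<le> (sum w X - w f * card X) / 2" using F(3) by simp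
    have wf: "0 \<le> w f" using f XH w by blast
    have "sum w F \<le> (\<Sum>e\<in>F. w' e + w f)" using wf by (intro sum_mono) (auto simp: w'_def)
    also have "\<dots> = sum w' F + w f * card F" by (simp add: sum.distrib)
    finally have 2: "sum w F \<le> sum w' F + w f * card F" .
    \<comment> \<open>The two strict inequalities leave room for \<open>f\<close>: half of the
      amount taken off \<open>X\<close> covers \<open>w f\<close> for each edge of \<open>F\<close>
      and once more for \<open>f\<close>.\<close>
    have "real (card F) + 2 \<le> card (range c)" using F(2) card' by linarith
    moreover have "2 * real (card (range c)) \<le> card X" using kX by linarith
    ultimately have "2 * real (card F) + 2 \<le> card X" by linarith
    then have "w f * (2 * real (card F) + 2) \<le> w f * card X" using wf by (rule mult_left_mono)
    then have 3: "2 * (w f * card F) + 2 * w f \<le> w f * card X" by (simp add: algebra_simps)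
    have "sum w (insert f F) \<le> w f + sum w F" using wf by (simp add: sum.insert_if)
    with 1 2 3 have "sum w (insert f F) \<le> sum w X / 2" by (simp add: field_simps)
    moreover have "card (insert f F) < card (range c)"
      using F(2) card' by (simp add: card_insert_if)
    moreover have "connects c (insert f F)"
      unfolding connects_def
    proof (intro allI impI)
      fix S
      assume S: "S \<noteq> {}" "label_closed c S" "edge_cut (insert f F) S = {}"
      have "edge_cut F S = {}" using S(3) by (auto simp: edge_cut_def)
      moreover have "x \<in> S \<longleftrightarrow> y \<in> S" using S(3) by (auto simp: edge_cut_def xy)
      then have "label_closed c' S" using S(2) unfolding label_closed_def c'_def by metis
      ultimately show "S = UNIV" using con S(1) by (simp add: connects_def)
    qed
    moreover have "insert f F \<subseteq> H" using f XH F by blast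
    ultimately show ?thesis unfolding X_def by (intro exI[of _ "insert f F"]) simp
  qed
qed

section \<open>Hamiltonian cycles and the tour polyhedron\<close>

text \<open>Replaces the list of nodes by all that is needed of the cycle: a connected 2-regular
  subgraph on all nodes.\<close>

lemma hamiltonian_two_factor:
  assumes "hamiltonian (E :: 'v::finite set set)" "E \<subseteq> K_edges"
  obtains H where "H \<subseteq> E" "graph_connected H" "\<And>v. deg H v = 2"
proof -
  obtain vs where vs: "3 \<le> length vs" "distinct vs" "set vs = UNIV"
    "\<And>i. Suc i < length vs \<Longrightarrow> {vs ! i, vs ! Suc i} \<in> E" "{last vs, hd vs} \<in> E"
    using assms(1) unfolding hamiltonian_def by blast
  define n where "n = length vs"
  define s where "s i = (if Suc i = n then 0 else Suc i)" for i
  define h where "h i = {vs ! i, vs ! s i}" for i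
  define H where "H = h ` {..<n}"
  have n: "3 \<le> n" using vs by (simp add: n_def)
  have s: "s i < n" if "i < n" for i using that n by (auto simp: s_def)
  have nth: "vs ! i = vs ! j \<longleftrightarrow> i = j" if "i < n" "j < n" for i j
    using that vs(2) by (simp add: n_def nth_eq_iff_index_eq)
  have idx: "\<exists>i<n. v = vs ! i" for v using vs(3) by (metis UNIV_I in_set_conv_nth n_def)
  have HE: "H \<subseteq> E"
  proof
    fix e
    assume "e \<in> H"
    then obtain i where i: "i < n" "e = h i" by (auto simp: H_def)
    show "e \<in> E"
    proof (cases "Suc i = n")
      case True
      have "vs \<noteq> []" using n by (auto simp: n_def)
      then have "last vs = vs ! i" "hd vs = vs ! 0"
        using True by (simp_all add: last_conv_nth hd_conv_nth n_def[symmetric] flip: True)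
      then show ?thesis using vs(5) i True by (simp add: h_def s_def)
    next
      case False
      then show ?thesis using vs(4)[of i] i by (simp add: h_def s_def n_def)
    qed
  qed
  moreover have "graph_connected H"
    unfolding graph_connected_iff_cut[OF subset_trans[OF HE assms(2)]]
  proof (intro allI impI notI)
    fix S :: "'v set"
    assume S: "S \<noteq> {} \<and> S \<noteq> UNIV" and c: "edge_cut H S = {}"
    have step: "vs ! i \<in> S \<longleftrightarrow> vs ! s i \<in> S" if "i < n" for i
    proof -
      have "h i \<notin> edge_cut H S" using c by simp
      then show ?thesis using that by (auto simp: H_def edge_cut_def h_def)
    qed
    have all: "vs ! i \<in> S \<longleftrightarrow> vs ! 0 \<in> S" if "i < n" for i
      using that
    proof (induction i)
      case (Suc i)
      then show ?case using step[of i] by (simp add: s_def)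
    qed simp
    then have "v \<in> S \<longleftrightarrow> vs ! 0 \<in> S" for v using idx[of v] by blast
    then show False using S by blast
  qed
  moreover have "deg H v = 2" for v
  proof -
    obtain j where j: "j < n" "v = vs ! j" using idx by blast
    define p where "p = (if j = 0 then n - 1 else j - 1)"
    have p: "p < n" "s p = j" using n j by (auto simp: p_def s_def)
    have sp: "i = p" if "i < n" "s i = j" for i
      using that n by (auto simp: p_def s_def split: if_splits)
    have ne: "p \<noteq> j" "s j \<noteq> j" "s j \<noteq> p" using n j by (auto simp: p_def s_def)
    have "{e \<in> H. v \<in> e} = {h j, h p}"
    proof
      show "{e \<in> H. v \<in> e} \<subseteq> {h j, h p}"
      proof
        fix e
        assume "e \<in> {e \<in> H. v \<in> e}"
        then obtain i where i: "i < n" "e = h i" "v \<in> h i" by (auto simp: H_def)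
        then have "j = i \<or> j = s i" using j s nth by (auto simp: h_def)
        then show "e \<in> {h j, h p}" using sp[of i] i by auto
      qed
      show "{h j, h p} \<subseteq> {e \<in> H. v \<in> e}" using j p by (auto simp: H_def h_def)
    qed
    moreover have "h j \<noteq> h p"
      using nth[OF s[OF j(1)] p(1)] nth[OF s[OF j(1)] j(1)] ne p by (auto simp: h_def doubleton_eq_iff)
    ultimately show ?thesis by (simp add: deg_def)
  qed
  ultimately show thesis by (rule that)
qed

section \<open>Domination and upward closure\<close>

text \<open>Otherwise a hyperplane separates the compact hull from the closed set of points below
  \<open>x\<close>. That set is unbounded downwards, so the normal is nonnegative, and
  \<open>dual\<close> contradicts the separation.\<close>

lemma dominated_convex_hull_point:
  fixes A :: "(real ^ 'n) set"
  assumes "finite A" and dual: "\<And>w :: real ^ 'n. (\<And>i. 0 \<le> w $ i) \<Longrightarrow> \<exists>a\<in>A. w \<bullet> a \<le> w \<bullet> x"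
  shows "\<exists>p\<in>convex hull A. \<forall>i. p $ i \<le> x $ i"
proof (rule ccontr)
  assume none: "\<not> ?thesis"
  define D where "D = {y :: real ^ 'n. \<forall>i. y $ i \<le> x $ i}"
  have D: "closed D" "convex D" "x \<in> D"
    by (auto simp: D_def convex_def closed_interval_left_cart intro: convex_bound_le)
  have "A \<noteq> {}" using dual[of 0] by auto
  then have "convex hull A \<noteq> {}" by simp
  moreover have "compact (convex hull A)" using assms(1) by (intro compact_convex_hull finite_imp_compact)
  moreover have "D \<inter> convex hull A = {}" using none by (auto simp: D_def)
  ultimately obtain w b where wb: "\<And>y. y \<in> D \<Longrightarrow> w \<bullet> y < b" "\<And>p. p \<in> convex hull A \<Longrightarrow> b < w \<bullet> p"
    using separating_hyperplane_closed_compact[OF D(2,1) convex_convex_hull] by metis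
  have "0 \<le> w $ i" for i
  proof (rule ccontr)
    assume "\<not> 0 \<le> w $ i"
    then have i: "w $ i < 0" by simp
    \<comment> \<open>The step down coordinate \<open>i\<close> at which the value of
      \<open>w\<close> has risen to exactly \<open>b\<close>.\<close>
    define t where "t = (b - w \<bullet> x) / (- (w $ i))"
    have "0 \<le> t" using wb(1)[OF D(3)] i unfolding t_def by (intro divide_nonneg_pos) auto
    then have "x - t *\<^sub>R axis i 1 \<in> D" by (auto simp: D_def axis_def)
    then have "w \<bullet> (x - t *\<^sub>R axis i 1) < b" by (rule wb)
    then have "w \<bullet> x - t * w $ i < b" by (simp add: inner_diff_right inner_axis)
    then show False using i by (simp add: t_def field_simps)
  qed
  then obtain a where "a \<in> A" "w \<bullet> a \<le> w \<bullet> x" using dual by blast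
  then show False using wb(1)[OF D(3)] wb(2)[of a] hull_inc[of a A convex] by auto
qed

text \<open>An even number of further copies of \<open>e\<close> turns a tour into a tour. Convex
  combinations with the original reach every smaller \<open>t\<close>, and convexity extends this
  from tours to the hull.\<close>

lemma tour_hull_add_axis:
  assumes "p \<in> tour_hull" "e \<in> K_edges" "0 \<le> t"
  shows "p + t *\<^sub>R axis e 1 \<in> (tour_hull :: (real ^ 'v::finite set) set)"
proof -
  have "incidence_vec J + t *\<^sub>R axis e 1 \<in> tour_hull" if J: "is_tour J" for J :: "'v set multiset"
  proof -
    obtain k :: nat where k: "t < real k" using reals_Archimedean2 by blast
    define J' where "J' = J + replicate_mset (2 * k) e"
    have tour: "is_tour J'"
    proof -
      have sub: "set_mset J \<subseteq> set_mset J'" "set_mset J' \<subseteq> K_edges"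
        using J assms(2) by (auto simp: J'_def is_tour_def)
      then have "graph_connected (set_mset J')"
        using J graph_connected_mono unfolding is_tour_def by blast
      moreover have "even (size {#e \<in># J'. v \<in> e#})" for v
      proof -
        have "{#e \<in># replicate_mset m e. v \<in> e#} = (if v \<in> e then replicate_mset m e else {#})" for m
          by (induction m) auto
        then show ?thesis using J by (simp add: J'_def is_tour_def)
      qed
      ultimately show ?thesis using sub by (simp add: is_tour_def)
    qed
    define s where "s = t / real (2 * k)"
    have k0: "0 < k" using k assms(3) by (cases k) auto
    have s: "0 \<le> s" "s \<le> 1" using k k0 assms(3) by (auto simp: s_def field_simps)
    have "incidence_vec J' = incidence_vec J + real (2 * k) *\<^sub>R axis e 1"
      by (auto simp: vec_eq_iff incidence_vec_def J'_def axis_def)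
    then have "incidence_vec J + t *\<^sub>R axis e 1 = (1 - s) *\<^sub>R incidence_vec J + s *\<^sub>R incidence_vec J'"
      using k0 by (simp add: s_def algebra_simps)
    moreover have "\<dots> \<in> tour_hull"
      unfolding tour_hull_def
      by (rule convexD[OF convex_convex_hull]) (use J tour s in \<open>auto intro: hull_inc\<close>)
    ultimately show ?thesis by simp
  qed
  then have "incidence_vec ` {J. is_tour J} \<subseteq> (\<lambda>p. p + t *\<^sub>R axis e 1) -` tour_hull" by auto
  moreover have "convex ((\<lambda>p. p + t *\<^sub>R axis e 1) -` (tour_hull :: (real ^ 'v set) set))"
  proof -
    have "(\<lambda>p. p + t *\<^sub>R axis e 1) -` (tour_hull :: (real ^ 'v set) set) =
        (\<lambda>p. (- (t *\<^sub>R axis e 1)) + p) ` tour_hull"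
      by (force simp: image_iff algebra_simps)
    then show ?thesis by (simp add: convex_translation tour_hull_def del: scaleR_minus_left)
  qed
  ultimately have "tour_hull \<subseteq> (\<lambda>p. p + t *\<^sub>R axis e 1) -` (tour_hull :: (real ^ 'v set) set)"
    by (subst tour_hull_def) (rule hull_minimal)
  with assms(1) show ?thesis by auto
qed

lemma tour_hull_upward_closed:
  fixes p x :: "real ^ 'v::finite set"
  assumes "p \<in> tour_hull" "\<And>e. p $ e \<le> x $ e" "\<And>e. e \<notin> K_edges \<Longrightarrow> p $ e = x $ e"
  shows "x \<in> tour_hull"
proof -
  have "p + (\<Sum>e\<in>B. (x $ e - p $ e) *\<^sub>R axis e 1) \<in> tour_hull" if "B \<subseteq> K_edges" for B
    using finite[of B] that
  proof (induction B rule: finite_induct)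
    case empty
    show ?case using assms by simp
  next
    case (insert e B)
    then have "p + (\<Sum>e\<in>B. (x $ e - p $ e) *\<^sub>R axis e 1) + (x $ e - p $ e) *\<^sub>R axis e 1 \<in> tour_hull"
      using assms(2)[of e] by (intro tour_hull_add_axis) auto
    then show ?case using insert by (simp add: algebra_simps)
  qed
  from this[of K_edges] have "p + (\<Sum>e\<in>K_edges. (x $ e - p $ e) *\<^sub>R axis e 1) \<in> tour_hull" by simp
  moreover have "p + (\<Sum>e\<in>K_edges. (x $ e - p $ e) *\<^sub>R axis e 1) = x"
    using assms(3) by (auto simp: vec_eq_iff axis_def if_distrib sum.If_cases cong: if_cong)
  ultimately show ?thesis by simp
qed

lemma even_deg_cut:
  assumes "H \<subseteq> (K_edges :: 'v::finite set set)" "\<And>v. even (deg H v)"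
  shows "even (card (edge_cut H S))"
  using cut_parity[OF assms(1), of S] assms(2) by simp

section \<open>The two candidate tours\<close>

text \<open>Two edge sets encode a tour with multiplicities at most two. There are only finitely
  many of these, so duality can be applied to a compact hull.\<close>

lemma tour_le_six_sevenths:
  fixes E :: "'v::finite set set" and w :: "'v set \<Rightarrow> real"
  assumes E: "E \<subseteq> K_edges" and "cubic E" "edge_connected 3 E" "hamiltonian E"
    and w: "\<And>e. e \<in> E \<Longrightarrow> 0 \<le> w e"
  shows "\<exists>A B. is_tour (mset_set A + mset_set B) \<and> sum w A + sum w B \<le> 6 / 7 * sum w E"
proof -
  obtain H where HE: "H \<subseteq> E" and Hcon: "graph_connected H" and Hdeg: "\<And>v. deg H v = 2"
    using hamiltonian_two_factor[OF assms(4) E] by blast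
  define M where "M = E - H"
  have HK: "H \<subseteq> K_edges" and EHM: "E = H \<union> M" "H \<inter> M = {}" using HE E by (auto simp: M_def)
  have cut3: "3 \<le> card (edge_cut E S)" if "S \<noteq> {}" "S \<noteq> UNIV" for S
    using edge_connected_cut assms(3) E that by blast
  have cutH_even: "even (card (edge_cut H S))" for S by (rule even_deg_cut[OF HK]) (simp add: Hdeg)
  have cutH: "2 \<le> card (edge_cut H S)" if "S \<noteq> {}" "S \<noteq> UNIV" for S
  proof -
    have "edge_cut H S \<noteq> {}" using Hcon that unfolding graph_connected_iff_cut[OF HK] by blast
    then have "card (edge_cut H S) \<noteq> 0" by simp
    then show ?thesis using cutH_even[of S] by presburger
  qed
  have cut_split: "edge_cut E S = edge_cut H S \<union> edge_cut M S" "edge_cut H S \<inter> edge_cut M S = {}" for S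
    using EHM by (auto simp: edge_cut_def)
  then have card_split: "card (edge_cut E S) = card (edge_cut H S) + card (edge_cut M S)" for S
    by (simp add: card_Un_disjoint)
  have sum_split: "sum f (edge_cut E S) = sum f (edge_cut H S) + sum f (edge_cut M S)" for f :: "'v set \<Rightarrow> real" and S
    using cut_split by (simp add: sum.union_disjoint)
  have wE: "sum w E = sum w H + sum w M" using EHM by (simp add: sum.union_disjoint)

  have "card {e \<in> M. v \<in> e} = 1" for v
  proof -
    have "{e \<in> E. v \<in> e} = {e \<in> H. v \<in> e} \<union> {e \<in> M. v \<in> e}" using EHM by auto
    moreover have "{e \<in> H. v \<in> e} \<inter> {e \<in> M. v \<in> e} = {}" using EHM by auto
    ultimately have "card {e \<in> E. v \<in> e} = deg H v + card {e \<in> M. v \<in> e}"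
      by (simp add: card_Un_disjoint deg_def)
    then show ?thesis using assms(2) Hdeg by (simp add: cubic_def)
  qed
  then have "\<exists>e. {e \<in> M. v \<in> e} = {e}" for v by (meson card_1_singletonE)
  \<comment> \<open>\<open>M\<close> is a perfect matching, being cubic minus 2-regular. With
    \<open>m v\<close> the matching edge at \<open>v\<close>, the fibres of \<open>m\<close> are the
    edges of \<open>M\<close>, so contracting fibres contracts \<open>M\<close>.\<close>
  then obtain m where "\<And>v. {e \<in> M. v \<in> e} = {m v}" by metis
  then have m: "m v \<in> M" "v \<in> m v" and m_unique: "e \<in> M \<Longrightarrow> v \<in> e \<Longrightarrow> m v = e" for v e
    by blast+
  have closed: "edge_cut M S = {}" if "label_closed m S" for S
  proof (rule ccontr)
    assume "edge_cut M S \<noteq> {}"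
    then obtain e where "e \<in> edge_cut M S" by blast
    then obtain u v where uv: "e = {u, v}" "u \<in> S" "v \<notin> S" "e \<in> M"
      by (rule cut_edgeE) (use EHM E in auto)
    then have "m u = m v" using m_unique[of e u] m_unique[of e v] by simp
    then show False using that uv unfolding label_closed_def by blast
  qed
  have cut4: "4 \<le> card (edge_cut H S)"
    if "S \<noteq> {}" "S \<noteq> UNIV" "label_closed m S" for S
  proof -
    have "edge_cut M S = {}" by (rule closed) (rule that(3))
    then have "3 \<le> card (edge_cut H S)" using cut3[OF that(1,2)] card_split[of S] by simp
    then show ?thesis using cutH_even[of S] by presburger
  qed
  have "\<exists>F\<subseteq>H. card F < card (range m) \<and> sum w F \<le> sum w {e \<in> H. card (m ` e) = 2} / 2 \<and>
    connects m F"
    using HK HE w cut4 by (intro connector_le_half) auto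
  then obtain F where FH: "F \<subseteq> H" and F: "sum w F \<le> sum w {e \<in> H. card (m ` e) = 2} / 2"
    and Fcon: "connects m F"
    by blast
  have "sum w {e \<in> H. card (m ` e) = 2} \<le> sum w H" using HE w by (intro sum_mono2) auto
  with F have F_le: "sum w F \<le> sum w H / 2" by simp
  define A where "A = M \<union> F"
  have AE: "A \<subseteq> E" and AK: "A \<subseteq> K_edges" using EHM FH E by (auto simp: A_def)
  have wA: "sum w A = sum w M + sum w F" using EHM FH by (subst A_def, subst sum.union_disjoint) auto
  have Acut: "edge_cut A S \<noteq> {}" if "S \<noteq> {}" "S \<noteq> UNIV" for S
  proof
    assume c: "edge_cut A S = {}"
    have "v \<in> S" if uv: "m u = m v" "u \<in> S" for u v
    proof (cases "u = v")
      case False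
      have mu: "m u \<in> M" "u \<in> m u" "v \<in> m u" using m[of u] m[of v] uv(1) by simp_all
      then have "m u \<notin> edge_cut A S" "m u \<in> A" using c by (auto simp: A_def)
      then show ?thesis using mu uv(2) by (auto simp: edge_cut_def)
    qed (use uv in simp)
    moreover have "edge_cut F S = {}" using c by (auto simp: A_def edge_cut_def)
    ultimately show False using Fcon that unfolding connects_def label_closed_def by blast
  qed

  define T where "T = {v. odd (deg A v)}"
  have T: "even (card T)" using cut_parity[OF AK, of UNIV] by (simp add: T_def edge_cut_def)
  have Econ: "graph_connected E" using Hcon HE by (rule graph_connected_mono)
  define z :: "'v set \<Rightarrow> real" where "z e = (if e \<in> H then 1 / 4 else 1 / 2)" for e
  have zcut: "1 \<le> sum z (edge_cut E S)" if "odd (card (S \<inter> T))" for S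
  proof -
    have "sum z (edge_cut H S) = (\<Sum>e\<in>edge_cut H S. 1 / 4)"
      by (intro sum.cong) (auto simp: z_def edge_cut_def)
    moreover have "sum z (edge_cut M S) = (\<Sum>e\<in>edge_cut M S. 1 / 2)"
      using EHM by (intro sum.cong) (auto simp: z_def edge_cut_def)
    ultimately have z: "sum z (edge_cut E S) = card (edge_cut H S) / 4 + card (edge_cut M S) / 2"
      by (simp add: sum_split)
    \<comment> \<open>As \<open>card T\<close> is even, neither trivial set meets \<open>T\<close>
      in an odd number of nodes.\<close>
    have "S \<noteq> {}" "S \<noteq> UNIV" using that T by auto
    then have "3 \<le> card (edge_cut H S) + card (edge_cut M S)" "2 \<le> card (edge_cut H S)"
      using cut3[of S] cutH[of S] by (simp_all add: card_split)
    then have "4 \<le> card (edge_cut H S) + 2 * card (edge_cut M S)" using cutH_even[of S] by presburger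
    then have "4 \<le> real (card (edge_cut H S)) + 2 * real (card (edge_cut M S))" by linarith
    then show ?thesis by (simp add: z)
  qed
  have "\<exists>J. is_join E T J \<and> sum w J \<le> (\<Sum>e\<in>E. w e * z e)"
    by (rule join_le_fractional[OF E Econ T w _ zcut]) (simp_all add: z_def)
  then obtain J where J: "is_join E T J" "sum w J \<le> (\<Sum>e\<in>E. w e * z e)" by blast
  have "(\<Sum>e\<in>E. w e * z e) = (\<Sum>e\<in>H. w e * z e) + (\<Sum>e\<in>M. w e * z e)"
    using EHM by (simp add: sum.union_disjoint)
  also have "(\<Sum>e\<in>H. w e * z e) = (\<Sum>e\<in>H. w e / 4)" by (intro sum.cong) (auto simp: z_def)
  also have "(\<Sum>e\<in>M. w e * z e) = (\<Sum>e\<in>M. w e / 2)" using EHM by (intro sum.cong) (auto simp: z_def)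
  finally have "sum w J \<le> sum w H / 4 + sum w M / 2" using J(2) by (simp add: sum_divide_distrib)
  with wA F_le have AJ: "sum w A + sum w J \<le> 3 / 4 * sum w H + 3 / 2 * sum w M" by simp
  have JE: "J \<subseteq> E" using J by (simp add: is_join_def)
  \<comment> \<open>Edges common to \<open>A\<close> and \<open>J\<close> are kept twice, so degrees
    add; both summands are odd exactly on \<open>T\<close>.\<close>
  have "is_tour (mset_set A + mset_set J)"
    unfolding is_tour_def
  proof (intro conjI allI)
    show sub: "set_mset (mset_set A + mset_set J) \<subseteq> K_edges" using AE JE E by auto
    show "graph_connected (set_mset (mset_set A + mset_set J))"
      by (rule graph_connected_mono[of A]) (use Acut in \<open>auto simp: graph_connected_iff_cut[OF AK]\<close>)
    fix v
    show "even (size {#e \<in># mset_set A + mset_set J. v \<in> e#})"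
      using J(1) by (simp add: is_join_def T_def deg_def)
  qed
  moreover have "is_tour (mset_set H + mset_set {})"
    using HK Hcon Hdeg by (simp add: is_tour_def deg_def)
  moreover have "sum w H + sum w {} \<le> 6 / 7 * sum w E \<or> sum w A + sum w J \<le> 6 / 7 * sum w E"
    using AJ wE by (simp, linarith)
  ultimately show ?thesis by blast
qed

theorem theorem4:
  fixes E :: "'v::finite set set"
  assumes "E \<subseteq> K_edges"
    and "cubic E"
    and "edge_connected 3 E"
    and "hamiltonian E"
  shows "everywhere_vec (6 / 7) E \<in> tour_hull"
proof -
  define x where "x = everywhere_vec (6 / 7) E"
  define Q where "Q = (\<lambda>(A, B). incidence_vec (mset_set A + mset_set B)) `
    {(A, B). is_tour (mset_set A + mset_set (B :: 'v set set))}"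
  have inner: "u \<bullet> incidence_vec (mset_set A + mset_set B) = sum (($) u) A + sum (($) u) B"
    for u :: "real ^ 'v set" and A B
  proof -
    have "u $ e * incidence_vec (mset_set A + mset_set B) $ e =
        (if e \<in> A then u $ e else 0) + (if e \<in> B then u $ e else 0)" for e
      by (simp add: incidence_vec_def count_mset_set')
    then show ?thesis by (simp add: inner_vec_def sum.distrib sum.If_cases)
  qed
  have "\<exists>p\<in>convex hull Q. \<forall>e. p $ e \<le> x $ e"
  proof (rule dominated_convex_hull_point)
    show "finite Q" by (simp add: Q_def)
    fix u :: "real ^ 'v set"
    assume "\<And>e. 0 \<le> u $ e"
    then obtain A B where AB: "is_tour (mset_set A + mset_set B)"
      "sum (($) u) A + sum (($) u) B \<le> 6 / 7 * sum (($) u) E"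
      using tour_le_six_sevenths[OF assms, of "($) u"] by blast
    have "u $ e * x $ e = (if e \<in> E then 6 / 7 * u $ e else 0)" for e
      by (simp add: x_def everywhere_vec_def)
    then have "u \<bullet> x = 6 / 7 * sum (($) u) E"
      by (simp add: inner_vec_def sum.If_cases sum_distrib_left)
    then show "\<exists>a\<in>Q. u \<bullet> a \<le> u \<bullet> x"
      using AB by (intro bexI[of _ "incidence_vec (mset_set A + mset_set B)"]) (auto simp: Q_def inner)
  qed
  then obtain p where p: "p \<in> convex hull Q" "\<And>e. p $ e \<le> x $ e" by blast
  have "Q \<subseteq> incidence_vec ` {J. is_tour J}" by (auto simp: Q_def)
  then have "p \<in> tour_hull" using p(1) hull_mono unfolding tour_hull_def by blast
  \<comment> \<open>Outside the edges of the complete graph, where nothing can be raised,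
    \<open>p\<close> is squeezed between 0 and the value 0 of \<open>x\<close>.\<close>
  moreover have "p $ e = x $ e" if "e \<notin> K_edges" for e
  proof -
    have "convex {p :: real ^ 'v set. 0 \<le> p $ e}" by (auto simp: convex_def)
    moreover have "Q \<subseteq> {p. 0 \<le> p $ e}" by (auto simp: Q_def incidence_vec_def)
    ultimately have "convex hull Q \<subseteq> {p. 0 \<le> p $ e}" by (intro hull_minimal)
    then have "0 \<le> p $ e" using p by blast
    moreover have "x $ e = 0" using that assms(1) by (auto simp: x_def everywhere_vec_def)
    ultimately show ?thesis using p(2)[of e] by simp
  qed
  ultimately show ?thesis using tour_hull_upward_closed p(2) x_def by blast
qed

end
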